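(* Let $\varepsilon\ge0$. If the 2-snapshot predictor $g$ associated with a higher-order predictor $(m,\sigma^2)$ is $\varepsilon$-second-order calibrated with respect to the partition $[\cdot]$ in the worst-case sense, i.e. $W_1\big(g(x),\mathrm{proj}_2f^*([x])\big)\le\varepsilon$ for all $x\in\mathcal X$, then $$\mathrm{CE}_2\le\tfrac32\,\varepsilon.$$
   Context: $X$ is a random input in $\mathcal X$ with law $D_X$, $f^*(x)=P(Y=1\mid X=x)$ for a label $Y\in\{0,1\}$. A partition $[\cdot]$ of $\mathcal X$ is fixed; $[x]$ denotes the element containing $x$. A higher-order predictor $(m,\sigma^2)$, with $m\in[0,1]$, $\sigma^2\in[0,m(1-m)]$, is constant on partition elements, with values $m([x])$, $\sigma^2([x])$, and $v([x])=m([x])^2+\sigma^2([x])$. Put $\eta_j([x])=\mathbb E[f^*(X)^j\mid X\in[x]]$ for $j=1,2$, $\delta_1([x])=|\eta_1([x])-m([x])|$, $\delta_2([x])=|\eta_2([x])-v([x])|$, and $\mathrm{CE}_2=\mathbb E_{[x]\sim D_X}[\delta_1([x])+\delta_2([x])]$. A 2-snapshot is a pair $(y_1,y_2)\in\{0,1\}^2$ with $y_1,y_2$ i.i.d. $\mathrm{Bernoulli}(f^*(x))$ given $x$; it is identified with its empirical distribution on $\{0,1\}$, so the symmetrized snapshot space is $Y^{(2)}=\{0,\tfrac12,1\}$ (the atom is the fraction of ones), a subset of the set $\Delta Y$ of distributions on $\{0,1\}$. $\mathrm{proj}_2f^*([x])$ is the true distribution on $Y^{(2)}$ of symmetrized 2-snapshots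 drawn from $[x]$ (draw $X$ conditionally on $X\in[x]$, then two i.i.d. labels). The 2-snapshot predictor associated with $(m,\sigma^2)$ is $g(x)=(q_0,q_{1/2},q_1)\in\Delta Y^{(2)}$ with $q_1=v([x])$, $q_{1/2}=2(m([x])-v([x]))$, $q_0=1-2m([x])+v([x])$. $W_1$ is the Wasserstein-1 distance with ground metric the $\ell_1$ distance on $\Delta Y$ (so $d(0,\tfrac12)=d(\tfrac12,1)=1$, $d(0,1)=2$). *)

theory Defs
  imports "HOL-Probability.Probability"
begin

text \<open>
  Labels in \<open>{0, 1}\<close> are booleans (\<open>True\<close> is the label 1), and distributions on the label
  set are elements of \<open>bool pmf\<close>.
\<close>

text \<open>
  \<open>f\<close> is a version of \<open>x \<mapsto> P(Y = 1 | X = x)\<close>, for an input \<open>X\<close> with values in \<open>S\<close>.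
\<close>

definition label_probability ::
  "'w measure \<Rightarrow> 'a measure \<Rightarrow> ('w \<Rightarrow> 'a) \<Rightarrow> ('w \<Rightarrow> bool) \<Rightarrow> ('a \<Rightarrow> real) \<Rightarrow> bool" where
  "label_probability M S X Y f \<longleftrightarrow>
     f \<in> borel_measurable S \<and> (\<forall>x\<in>space S. 0 \<le> f x \<and> f x \<le> 1) \<and>
     (\<forall>A\<in>sets S. measure M {w \<in> space M. X w \<in> A \<and> Y w} =
        set_lebesgue_integral (distr M S X) A f)"

definition cell :: "'a set set \<Rightarrow> 'a \<Rightarrow> 'a set" where
  "cell P x = (THE c. c \<in> P \<and> x \<in> c)"

text \<open>
  \<open>\<kappa> c\<close> is the law of the input (with law \<open>D\<close>) conditionally on lying in the partition element
  \<open>c\<close>. Cells may be null sets (there may be uncountably many of them), so the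
  conditional laws are a disintegration of \<open>D\<close> along the partition: \<open>\<kappa> c\<close> is concentrated on
  \<open>c\<close>, depends measurably on the cell, and satisfies the law of total probability. On a cell of
  positive probability this forces the elementary conditional law
  (lemma \<open>conditional_laws_eq_uniform_measure\<close>), and for countable measurable
  partitions conditional laws always exist (lemma \<open>conditional_laws_exist\<close>).
\<close>

definition conditional_laws ::
  "'a measure \<Rightarrow> 'a set set \<Rightarrow> ('a set \<Rightarrow> 'a measure) \<Rightarrow> bool" where
  "conditional_laws D P \<kappa> \<longleftrightarrow>
     P \<subseteq> sets D \<and>
     (\<lambda>x. \<kappa> (cell P x)) \<in> D \<rightarrow>\<^sub>M prob_algebra D \<and>
     (\<forall>c\<in>P. emeasure (\<kappa> c) c = 1) \<and>
     (\<forall>A\<in>sets D. emeasure D A = (\<integral>\<^sup>+x. emeasure (\<kappa> (cell P x)) A \<partial>D))"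

text \<open>
  Functions that are constant on partition elements are represented as functions of the cell.
\<close>

definition higher_order_predictor ::
  "'a measure \<Rightarrow> 'a set set \<Rightarrow> ('a set \<Rightarrow> real) \<Rightarrow> ('a set \<Rightarrow> real) \<Rightarrow> bool" where
  "higher_order_predictor S P m s2 \<longleftrightarrow>
     (\<lambda>x. m (cell P x)) \<in> borel_measurable S \<and>
     (\<lambda>x. s2 (cell P x)) \<in> borel_measurable S \<and>
     (\<forall>c\<in>P. 0 \<le> m c \<and> m c \<le> 1 \<and> 0 \<le> s2 c \<and> s2 c \<le> m c * (1 - m c))"

definition second_moment :: "('a set \<Rightarrow> real) \<Rightarrow> ('a set \<Rightarrow> real) \<Rightarrow> 'a set \<Rightarrow> real" where
  "second_moment m s2 c = (m c)\<^sup>2 + s2 c"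

definition eta :: "('a set \<Rightarrow> 'a measure) \<Rightarrow> ('a \<Rightarrow> real) \<Rightarrow> nat \<Rightarrow> 'a set \<Rightarrow> real" where
  "eta \<kappa> f j c = (\<integral>x. f x ^ j \<partial>\<kappa> c)"

definition delta1 ::
  "('a set \<Rightarrow> 'a measure) \<Rightarrow> ('a \<Rightarrow> real) \<Rightarrow> ('a set \<Rightarrow> real) \<Rightarrow> 'a set \<Rightarrow> real" where
  "delta1 \<kappa> f m c = \<bar>eta \<kappa> f 1 c - m c\<bar>"

definition delta2 ::
  "('a set \<Rightarrow> 'a measure) \<Rightarrow> ('a \<Rightarrow> real) \<Rightarrow> ('a set \<Rightarrow> real) \<Rightarrow> ('a set \<Rightarrow> real) \<Rightarrow> 'a set \<Rightarrow> real"
  where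
  "delta2 \<kappa> f m s2 c = \<bar>eta \<kappa> f 2 c - second_moment m s2 c\<bar>"

definition CE2 ::
  "'a measure \<Rightarrow> 'a set set \<Rightarrow> ('a set \<Rightarrow> 'a measure) \<Rightarrow> ('a \<Rightarrow> real) \<Rightarrow>
   ('a set \<Rightarrow> real) \<Rightarrow> ('a set \<Rightarrow> real) \<Rightarrow> real" where
  "CE2 D P \<kappa> f m s2 =
     (\<integral>x. delta1 \<kappa> f m (cell P x) + delta2 \<kappa> f m s2 (cell P x) \<partial>D)"

text \<open>
  A 2-snapshot is identified with its empirical distribution, so \<open>snapshot False False\<close>,
  \<open>snapshot False True\<close> and \<open>snapshot True True\<close> are the atoms 0, 1/2 and 1.
\<close>

definition snapshot :: "bool \<Rightarrow> bool \<Rightarrow> bool pmf" where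
  "snapshot y1 y2 = pmf_of_multiset {#y1, y2#}"

definition snapshot_law :: "real \<Rightarrow> bool pmf pmf" where
  "snapshot_law p =
     map_pmf (\<lambda>(y1, y2). snapshot y1 y2) (pair_pmf (bernoulli_pmf p) (bernoulli_pmf p))"

text \<open>
  The law of the snapshot when first \<open>x\<close> is drawn from \<open>\<kappa> c\<close> and then the snapshot is drawn from
  \<open>snapshot_law (f x)\<close>, given by its point masses (see lemma \<open>pmf_proj2\<close>).
\<close>

definition proj2 ::
  "('a set \<Rightarrow> 'a measure) \<Rightarrow> ('a \<Rightarrow> real) \<Rightarrow> 'a set \<Rightarrow> bool pmf pmf" where
  "proj2 \<kappa> f c = embed_pmf (\<lambda>s. \<integral>x. pmf (snapshot_law (f x)) s \<partial>\<kappa> c)"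

definition snapshot_predictor ::
  "('a set \<Rightarrow> real) \<Rightarrow> ('a set \<Rightarrow> real) \<Rightarrow> 'a set \<Rightarrow> bool pmf pmf" where
  "snapshot_predictor m s2 c =
     (let v = second_moment m s2 c in
      pmf_of_list
        [(snapshot False False, 1 - 2 * m c + v),
         (snapshot False True, 2 * (m c - v)),
         (snapshot True True, v)])"

definition l1_dist :: "bool pmf \<Rightarrow> bool pmf \<Rightarrow> real" where
  "l1_dist p q = (\<Sum>b\<in>UNIV. \<bar>pmf p b - pmf q b\<bar>)"

definition W1 :: "bool pmf pmf \<Rightarrow> bool pmf pmf \<Rightarrow> real" where
  "W1 p q = (INF r\<in>{r. map_pmf fst r = p \<and> map_pmf snd r = q}.
     measure_pmf.expectation r (\<lambda>(s, t). l1_dist s t))"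

definition second_order_calibrated ::
  "'a measure \<Rightarrow> 'a set set \<Rightarrow> ('a set \<Rightarrow> 'a measure) \<Rightarrow> ('a \<Rightarrow> real) \<Rightarrow>
   ('a \<Rightarrow> bool pmf pmf) \<Rightarrow> real \<Rightarrow> bool" where
  "second_order_calibrated S P \<kappa> f g \<epsilon> \<longleftrightarrow>
     (\<forall>x\<in>space S. W1 (g x) (proj2 \<kappa> f (cell P x)) \<le> \<epsilon>)"

subsection \<open>Well-definedness of the notions above\<close>

lemma cell_eq:
  assumes "partition_on A P" "c \<in> P" "x \<in> c"
  shows "cell P x = c"
  unfolding cell_def
  using assms partition_onD2[OF assms(1)] by (intro the_equality) (auto simp: disjoint_def)

lemma cell_mem:
  assumes "partition_on A P" "x \<in> A"
  shows "cell P x \<in> P" "x \<in> cell P x"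
  using assms cell_eq[OF assms(1)] partition_onD1[OF assms(1)] by force+

lemma conditional_laws_prob_space:
  assumes "partition_on (space D) P" "conditional_laws D P \<kappa>" "c \<in> P"
  shows "prob_space (\<kappa> c)" "sets (\<kappa> c) = sets D"
proof -
  obtain x where x: "x \<in> c"
    using assms(3) partition_onD3[OF assms(1)] by fastforce
  have "x \<in> space D"
    using x assms(3) partition_onD1[OF assms(1)] by auto
  moreover have "(\<lambda>x. \<kappa> (cell P x)) \<in> D \<rightarrow>\<^sub>M prob_algebra D"
    using assms(2) by (simp add: conditional_laws_def)
  ultimately have "\<kappa> (cell P x) \<in> space (prob_algebra D)"
    by (rule measurable_space[rotated])
  then show "prob_space (\<kappa> c)" "sets (\<kappa> c) = sets D"
    using cell_eq[OF assms(1,3) x] by (auto simp: space_prob_algebra)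
qed

lemma conditional_laws_eq_uniform_measure:
  assumes D: "prob_space D" and P: "partition_on (space D) P"
    and \<kappa>: "conditional_laws D P \<kappa>" and c: "c \<in> P" and pos: "emeasure D c \<noteq> 0"
  shows "\<kappa> c = uniform_measure D c"
proof (rule measure_eqI)
  interpret D: prob_space D by (rule D)
  show sets_eq: "sets (\<kappa> c) = sets (uniform_measure D c)"
    using conditional_laws_prob_space[OF P \<kappa> c] by simp
  fix A assume "A \<in> sets (\<kappa> c)"
  then have A: "A \<in> sets D" using sets_eq by simp
  have cD: "c \<in> sets D" using \<kappa> c by (auto simp: conditional_laws_def)
  have conc: "emeasure (\<kappa> d) (A \<inter> c) = (if d = c then emeasure (\<kappa> c) A else 0)" if d: "d \<in> P" for d
  proof -
    interpret K: prob_space "\<kappa> d" by (rule conditional_laws_prob_space[OF P \<kappa> d])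
    note sd = conditional_laws_prob_space(2)[OF P \<kappa> d]
    have dD: "d \<in> sets D" using \<kappa> d by (auto simp: conditional_laws_def)
    have "emeasure (\<kappa> d) d = 1" using \<kappa> d by (auto simp: conditional_laws_def)
    then have ae: "AE x in \<kappa> d. x \<in> d"
      using dD sd by (simp add: K.AE_in_set_eq_1 K.emeasure_eq_measure)
    show ?thesis
    proof (cases "d = c")
      case True
      have "emeasure (\<kappa> d) (A \<inter> c) = emeasure (\<kappa> d) A"
        using ae True A cD sd by (intro emeasure_eq_AE) auto
      with True show ?thesis by simp
    next
      case False
      then have "d \<inter> c = {}" using partition_onD2[OF P] c d by (auto simp: disjoint_def)
      then have "emeasure (\<kappa> d) (A \<inter> c) = emeasure (\<kappa> d) {}"
        using ae A cD sd by (intro emeasure_eq_AE) auto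
      with False show ?thesis by simp
    qed
  qed
  have "emeasure D (A \<inter> c) = (\<integral>\<^sup>+x. emeasure (\<kappa> (cell P x)) (A \<inter> c) \<partial>D)"
    using \<kappa> A cD by (auto simp: conditional_laws_def)
  also have "\<dots> = (\<integral>\<^sup>+x. emeasure (\<kappa> c) A * indicator c x \<partial>D)"
  proof (rule nn_integral_cong)
    fix x assume x: "x \<in> space D"
    have "cell P x = c \<longleftrightarrow> x \<in> c"
      using cell_mem[OF P x] cell_eq[OF P c] by auto
    then show "emeasure (\<kappa> (cell P x)) (A \<inter> c) = emeasure (\<kappa> c) A * indicator c x"
      using conc[OF cell_mem(1)[OF P x]] by (auto simp: indicator_def)
  qed
  also have "\<dots> = emeasure (\<kappa> c) A * emeasure D c"
    using cD by (simp add: nn_integral_cmult_indicator)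
  finally have "emeasure D (c \<inter> A) = emeasure (\<kappa> c) A * emeasure D c"
    by (simp add: Int_commute)
  then show "emeasure (\<kappa> c) A = emeasure (uniform_measure D c) A"
    using A cD pos D.emeasure_finite[of c]
    by (simp add: ennreal_mult_divide_eq)
qed

lemma conditional_laws_exist:
  assumes D: "prob_space D" and P: "partition_on (space D) P"
    and count: "countable P" and meas: "P \<subseteq> sets D"
  shows "\<exists>\<kappa>. conditional_laws D P \<kappa>"
proof -
  interpret D: prob_space D by (rule D)
  define \<kappa> where "\<kappa> c = (if emeasure D c = 0 then return D (SOME x. x \<in> c) else uniform_measure D c)"
    for c
  have some: "(SOME x. x \<in> c) \<in> c" if "c \<in> P" for c
    using that partition_onD3[OF P] by (metis some_in_eq)
  have sub: "c \<subseteq> space D" if "c \<in> P" for c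
    using that partition_onD1[OF P] by auto
  have prob: "\<kappa> c \<in> space (prob_algebra D)" if "c \<in> P" for c
    using some[OF that] sub[OF that] D.emeasure_finite[of c]
    by (auto simp: \<kappa>_def space_prob_algebra intro!: prob_space_return prob_space_uniform_measure)
  have mc: "cell P \<in> D \<rightarrow>\<^sub>M count_space P"
  proof (rule measurable_count_space_eq_countable[THEN iffD2, OF count], intro conjI ballI)
    show "cell P \<in> space D \<rightarrow> P" using cell_mem[OF P] by auto
    fix c assume c: "c \<in> P"
    have "cell P -` {c} \<inter> space D = c"
      using cell_mem[OF P] cell_eq[OF P c] sub[OF c] by auto
    then show "cell P -` {c} \<inter> space D \<in> sets D" using c meas by auto
  qed
  have mk: "(\<lambda>x. \<kappa> (cell P x)) \<in> D \<rightarrow>\<^sub>M prob_algebra D"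
    using prob by (intro measurable_compose[OF mc]) auto
  have one: "emeasure (\<kappa> c) c = 1" if "c \<in> P" for c
    using some[OF that] meas that D.emeasure_finite[of c]
    by (auto simp: \<kappa>_def intro!: emeasure_uniform_measure_1)
  have tot: "emeasure D A = (\<integral>\<^sup>+x. emeasure (\<kappa> (cell P x)) A \<partial>D)" if A: "A \<in> sets D" for A
  proof -
    have un: "(\<Union>c\<in>P. c) = space D" using partition_onD1[OF P] by auto
    have "(\<integral>\<^sup>+x. emeasure (\<kappa> (cell P x)) A \<partial>D)
        = (\<integral>\<^sup>+x. (\<integral>\<^sup>+c. emeasure (\<kappa> c) A * indicator c x \<partial>count_space P) \<partial>D)"
    proof (rule nn_integral_cong)
      fix x assume x: "x \<in> space D"
      have "(\<integral>\<^sup>+c. emeasure (\<kappa> c) A * indicator c x \<partial>count_space P)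
          = (\<integral>\<^sup>+c. emeasure (\<kappa> (cell P x)) A * indicator {cell P x} c \<partial>count_space P)"
      proof (rule nn_integral_cong)
        fix c assume "c \<in> space (count_space P)"
        then have "x \<in> c \<longleftrightarrow> c = cell P x"
          using cell_mem(2)[OF P x] cell_eq[OF P, of c x] by auto
        then show "emeasure (\<kappa> c) A * indicator c x =
            emeasure (\<kappa> (cell P x)) A * indicator {cell P x} c"
          by (cases "x \<in> c") simp_all
      qed
      also have "\<dots> = emeasure (\<kappa> (cell P x)) A"
        using cell_mem[OF P x] by (subst nn_integral_cmult_indicator) auto
      finally show "emeasure (\<kappa> (cell P x)) A =
          (\<integral>\<^sup>+c. emeasure (\<kappa> c) A * indicator c x \<partial>count_space P)" by simp
    qed
    also have "\<dots> = (\<integral>\<^sup>+c. (\<integral>\<^sup>+x. emeasure (\<kappa> c) A * indicator c x \<partial>D) \<partial>count_space P)"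
      using meas by (intro nn_integral_count_space_nn_integral count) auto
    also have "\<dots> = (\<integral>\<^sup>+c. emeasure D (c \<inter> A) \<partial>count_space P)"
    proof (rule nn_integral_cong)
      fix c assume "c \<in> space (count_space P)"
      then have c: "c \<in> P" and cD: "c \<in> sets D" using meas by auto
      have "(\<integral>\<^sup>+x. emeasure (\<kappa> c) A * indicator c x \<partial>D) = emeasure (\<kappa> c) A * emeasure D c"
        using cD by (simp add: nn_integral_cmult_indicator)
      also have "\<dots> = emeasure D (c \<inter> A)"
      proof (cases "emeasure D c = 0")
        case True
        moreover have "emeasure D (c \<inter> A) \<le> emeasure D c"
          using cD by (intro emeasure_mono) auto
        ultimately show ?thesis by simp
      next
        case False
        then have "emeasure (\<kappa> c) A * emeasure D c =
            emeasure D (c \<inter> A) / emeasure D c * emeasure D c"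
          using A cD by (simp add: \<kappa>_def)
        also have "\<dots> = emeasure D (c \<inter> A)"
          using False D.emeasure_finite[of c]
          by (simp only: ennreal_divide_times ennreal_divide_self less_top mult_1_right not_False_eq_True)
        finally show ?thesis .
      qed
      finally show "(\<integral>\<^sup>+x. emeasure (\<kappa> c) A * indicator c x \<partial>D) = emeasure D (c \<inter> A)" .
    qed
    also have "\<dots> = emeasure D (\<Union>c\<in>P. c \<inter> A)"
    proof (rule emeasure_UN_countable[symmetric])
      show "disjoint_family_on (\<lambda>c. c \<inter> A) P"
        using partition_onD2[OF P] unfolding disjoint_family_on_def disjoint_def by blast
    qed (use meas A count in auto)
    also have "(\<Union>c\<in>P. c \<inter> A) = A"
      using un sets.sets_into_space[OF A] by auto
    finally show ?thesis by simp
  qed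
  show ?thesis
    using meas mk one tot by (auto simp: conditional_laws_def)
qed

lemma snapshot_distinct:
  "snapshot False True \<noteq> snapshot False False"
  "snapshot True True \<noteq> snapshot False False"
  "snapshot True True \<noteq> snapshot False True"
proof -
  have "pmf (snapshot False True) True = 1 / 2" "pmf (snapshot False False) True = 0"
    "pmf (snapshot True True) True = 1"
    by (simp_all add: snapshot_def)
  then show "snapshot False True \<noteq> snapshot False False"
    "snapshot True True \<noteq> snapshot False False" "snapshot True True \<noteq> snapshot False True"
    by auto
qed

lemma l1_dist_snapshot:
  "l1_dist (snapshot False False) (snapshot False True) = 1"
  "l1_dist (snapshot False True) (snapshot True True) = 1"
  "l1_dist (snapshot False False) (snapshot True True) = 2"
  by (simp_all add: l1_dist_def snapshot_def UNIV_bool)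

lemma snapshot_commute: "snapshot y1 y2 = snapshot y2 y1"
  by (simp add: snapshot_def add_mset_commute)

lemma pmf_snapshot_law:
  assumes "0 \<le> p" "p \<le> 1"
  shows "pmf (snapshot_law p) s =
     (1 - p)\<^sup>2 * of_bool (s = snapshot False False) +
     2 * p * (1 - p) * of_bool (s = snapshot False True) + p\<^sup>2 * of_bool (s = snapshot True True)"
proof -
  have "pmf (snapshot_law p) s = measure_pmf.expectation
      (bernoulli_pmf p) (\<lambda>y1. measure_pmf.expectation (bernoulli_pmf p)
        (\<lambda>y2. indicator {s} (snapshot y1 y2)))"
    unfolding snapshot_law_def pair_pmf_def map_bind_pmf map_return_pmf pmf_bind by simp
  also have "\<dots> = (1 - p)\<^sup>2 * of_bool (s = snapshot False False) +
     2 * p * (1 - p) * of_bool (s = snapshot False True) + p\<^sup>2 * of_bool (s = snapshot True True)"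
    using assms snapshot_commute[of True False]
    by (auto simp: indicator_def of_bool_def power2_eq_square algebra_simps)
  finally show ?thesis .
qed

lemma pmf_snapshot_predictor:
  assumes "0 \<le> m c" "m c \<le> 1" "0 \<le> s2 c" "s2 c \<le> m c * (1 - m c)"
  shows "pmf (snapshot_predictor m s2 c) s =
     (1 - 2 * m c + second_moment m s2 c) * of_bool (s = snapshot False False) +
     2 * (m c - second_moment m s2 c) * of_bool (s = snapshot False True) +
     second_moment m s2 c * of_bool (s = snapshot True True)"
proof -
  have "0 \<le> (1 - m c)\<^sup>2" by simp
  then have wf: "pmf_of_list_wf
        [(snapshot False False, 1 - 2 * m c + second_moment m s2 c),
         (snapshot False True, 2 * (m c - second_moment m s2 c)),
         (snapshot True True, second_moment m s2 c)]"
    using assms by (auto simp: pmf_of_list_wf_def second_moment_def power2_eq_square algebra_simps)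
  show ?thesis
    unfolding snapshot_predictor_def Let_def pmf_pmf_of_list[OF wf]
    using snapshot_distinct by auto
qed

lemma pmf_proj2:
  assumes K: "prob_space (\<kappa> c)" and f: "f \<in> borel_measurable (\<kappa> c)"
    and f01: "\<And>x. x \<in> space (\<kappa> c) \<Longrightarrow> 0 \<le> f x \<and> f x \<le> 1"
  shows "pmf (proj2 \<kappa> f c) s = (\<integral>x. pmf (snapshot_law (f x)) s \<partial>\<kappa> c)"
  unfolding proj2_def
proof (rule pmf_embed_pmf)
  interpret K: prob_space "\<kappa> c" by (rule K)
  have meas: "(\<lambda>x. pmf (snapshot_law (f x)) s) \<in> borel_measurable (\<kappa> c)" for s
  proof -
    have "(\<lambda>x. (1 - f x)\<^sup>2 * of_bool (s = snapshot False False) +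
       2 * f x * (1 - f x) * of_bool (s = snapshot False True) +
       (f x)\<^sup>2 * of_bool (s = snapshot True True)) \<in> borel_measurable (\<kappa> c)"
      using f by measurable
    then show ?thesis
      using f01 by (subst measurable_cong[OF pmf_snapshot_law]) auto
  qed
  show "0 \<le> (\<integral>x. pmf (snapshot_law (f x)) s \<partial>\<kappa> c)" for s
    by (intro integral_nonneg_AE) auto
  let ?A = "{snapshot False False, snapshot False True, snapshot True True}"
  have int: "integrable (\<kappa> c) (\<lambda>x. pmf (snapshot_law (f x)) s)" for s
    by (intro K.integrable_const_bound[where B = 1] meas) (auto simp: pmf_le_1)
  have zero: "(\<integral>x. pmf (snapshot_law (f x)) s \<partial>\<kappa> c) = 0" if "s \<notin> ?A" for s
  proof -
    have "(\<integral>x. pmf (snapshot_law (f x)) s \<partial>\<kappa> c) = (\<integral>x. 0 \<partial>\<kappa> c)"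
      using that f01 by (intro Bochner_Integration.integral_cong) (auto simp: pmf_snapshot_law)
    then show ?thesis by simp
  qed
  have "(\<integral>\<^sup>+s. ennreal (\<integral>x. pmf (snapshot_law (f x)) s \<partial>\<kappa> c) \<partial>count_space UNIV)
      = (\<Sum>s\<in>?A. ennreal (\<integral>x. pmf (snapshot_law (f x)) s \<partial>\<kappa> c))"
    using zero by (intro nn_integral_count_space') auto
  also have "\<dots> = ennreal (\<Sum>s\<in>?A. \<integral>x. pmf (snapshot_law (f x)) s \<partial>\<kappa> c)"
    by (intro sum_ennreal integral_nonneg_AE) auto
  also have "(\<Sum>s\<in>?A. \<integral>x. pmf (snapshot_law (f x)) s \<partial>\<kappa> c)
      = (\<integral>x. (\<Sum>s\<in>?A. pmf (snapshot_law (f x)) s) \<partial>\<kappa> c)"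
    using int by (intro Bochner_Integration.integral_sum[symmetric]) auto
  also have "\<dots> = (\<integral>x. 1 \<partial>\<kappa> c)"
  proof (rule Bochner_Integration.integral_cong)
    fix x assume "x \<in> space (\<kappa> c)"
    then have "0 \<le> f x" "f x \<le> 1" using f01 by auto
    then show "(\<Sum>s\<in>?A. pmf (snapshot_law (f x)) s) = 1"
      using snapshot_distinct snapshot_distinct[symmetric]
      by (simp add: pmf_snapshot_law power2_eq_square algebra_simps)
  qed simp
  also have "\<dots> = 1" by (simp add: K.prob_space)
  finally show "(\<integral>\<^sup>+s. ennreal (\<integral>x. pmf (snapshot_law (f x)) s \<partial>\<kappa> c) \<partial>count_space UNIV) = 1"
    by simp
qed

end

theory Submission
  imports Defs
begin

text \<open>
  The easy half of Kantorovich duality: a test function that is \<open>L\<close>-Lipschitz for the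
  \<open>l1\<close> distance separates two laws by at most \<open>L * W1\<close>. Writing \<open>x\<close> for the fraction of ones,
  the functions \<open>x \<plusminus> max 0 (2 x - 1)\<close> have slopes between \<open>-1\<close> and \<open>3\<close> in \<open>x\<close>, hence are
  \<open>3/2\<close>-Lipschitz because the \<open>l1\<close> distance is \<open>2 \<bar>x - y\<bar>\<close>. On the atoms \<open>0, 1/2, 1\<close> they take
  the values \<open>0, 1/2, 1 \<plusminus> 1\<close>, so their expectations are \<open>m \<plusminus> v\<close> under the
  predictor and \<open>\<eta>\<^sub>1 \<plusminus> \<eta>\<^sub>2\<close> under the true snapshot law. The larger of
  \<open>\<bar>(\<eta>\<^sub>1 - m) + (\<eta>\<^sub>2 - v)\<bar>\<close> and \<open>\<bar>(\<eta>\<^sub>1 - m) - (\<eta>\<^sub>2 - v)\<bar>\<close> is \<open>\<delta>\<^sub>1 + \<delta>\<^sub>2\<close>.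
\<close>

lemma l1_dist_eq: "l1_dist s t = 2 * \<bar>pmf s True - pmf t True\<bar>"
proof -
  have "pmf p False = 1 - pmf p True" for p :: "bool pmf"
    using pmf_False_conv_True by blast
  then show ?thesis by (simp add: l1_dist_def UNIV_bool abs_minus_commute)
qed

lemma l1_dist_nonneg: "0 \<le> l1_dist s t"
  by (simp add: l1_dist_eq)

lemma l1_dist_le_2: "l1_dist s t \<le> 2"
proof -
  have "\<bar>x - y\<bar> \<le> 1" if "0 \<le> x" "x \<le> 1" "0 \<le> y" "y \<le> 1" for x y :: real
    using that by linarith
  then show ?thesis
    by (simp add: l1_dist_eq pmf_le_1)
qed

text \<open>Along any coupling \<open>r\<close> the difference of expectations is the
  \<open>r\<close>-mean of \<open>\<phi> s - \<phi> t\<close>, which the transport cost of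
  \<open>r\<close> times \<open>L\<close> dominates.\<close>

lemma expectation_diff_le_W1:
  fixes \<phi> :: "bool pmf \<Rightarrow> real"
  assumes L: "0 < L" and lip: "\<And>s t. \<bar>\<phi> s - \<phi> t\<bar> \<le> L * l1_dist s t"
  shows "\<bar>measure_pmf.expectation p \<phi> - measure_pmf.expectation q \<phi>\<bar> \<le> L * W1 p q"
proof -
  let ?d = "\<bar>measure_pmf.expectation p \<phi> - measure_pmf.expectation q \<phi>\<bar>"
  \<comment> \<open>The \<open>l1\<close> diameter is 2, so being Lipschitz makes
    \<open>\<phi>\<close> bounded, hence integrable; \<open>undefined\<close> is just a base
    point.\<close>
  have bound: "\<bar>\<phi> s\<bar> \<le> \<bar>\<phi> undefined\<bar> + L * 2" for s
    using lip[of s undefined] mult_left_mono[OF l1_dist_le_2[of s undefined], of L] L by linarith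
  have "?d / L \<le> W1 p q"
    unfolding W1_def
  proof (rule cINF_greatest)
    \<comment> \<open>The independent coupling: a real infimum over the empty set would be
      unspecified.\<close>
    show "{r. map_pmf fst r = p \<and> map_pmf snd r = q} \<noteq> {}"
      using map_fst_pair_pmf[of p q] map_snd_pair_pmf[of p q] by blast
    fix r assume "r \<in> {r. map_pmf fst r = p \<and> map_pmf snd r = q}"
    then have r: "p = map_pmf fst r" "q = map_pmf snd r" by auto
    have int: "integrable (measure_pmf r) (\<lambda>z. \<phi> (fst z))"
      "integrable (measure_pmf r) (\<lambda>z. \<phi> (snd z))"
      by (rule measure_pmf.integrable_const_bound[where B = "\<bar>\<phi> undefined\<bar> + L * 2"];
          use bound in simp)+
    have intd: "integrable (measure_pmf r) (\<lambda>z. L * l1_dist (fst z) (snd z))"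
      using l1_dist_nonneg l1_dist_le_2
      by (intro integrable_mult_right measure_pmf.integrable_const_bound[where B = 2]) auto
    have "?d = \<bar>measure_pmf.expectation r (\<lambda>z. \<phi> (fst z) - \<phi> (snd z))\<bar>"
      using int by (simp add: r)
    also have "\<dots> \<le> measure_pmf.expectation r (\<lambda>z. \<bar>\<phi> (fst z) - \<phi> (snd z)\<bar>)"
      by (rule integral_abs_bound)
    also have "\<dots> \<le> measure_pmf.expectation r (\<lambda>z. L * l1_dist (fst z) (snd z))"
      using int intd lip by (intro integral_mono) auto
    also have "\<dots> = L * measure_pmf.expectation r (\<lambda>(s, t). l1_dist s t)"
      by (simp add: case_prod_unfold)
    finally show "?d / L \<le> measure_pmf.expectation r (\<lambda>(s, t). l1_dist s t)"
      using L by (simp add: field_simps)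
  qed
  then show ?thesis using L by (simp add: field_simps)
qed

text \<open>Couplings may have arbitrary marginals on \<open>bool pmf\<close>, so the test is
  extended off the three atoms, by linear interpolation between them.\<close>

definition moment_test :: "real \<Rightarrow> bool pmf \<Rightarrow> real" where
  "moment_test b s = pmf s True + b * max 0 (2 * pmf s True - 1)"

lemma moment_test_lipschitz:
  assumes "b = 1 \<or> b = - 1"
  shows "\<bar>moment_test b s - moment_test b t\<bar> \<le> 3 / 2 * l1_dist s t"
  using assms unfolding moment_test_def l1_dist_eq by (auto simp: max_def abs_if)

text \<open>The atom 1/2 contributes \<open>(2 * (a - c)) / 2\<close> and the atom 1 contributes
  \<open>(1 + b) * c\<close>. Generic \<open>a\<close> and \<open>c\<close> let the lemma serve both
  the predictor and the true law.\<close>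

lemma expectation_moment_test:
  assumes "\<And>s. pmf p s = (1 - 2 * a + c) * of_bool (s = snapshot False False) +
     2 * (a - c) * of_bool (s = snapshot False True) + c * of_bool (s = snapshot True True)"
  shows "measure_pmf.expectation p (moment_test b) = a + b * c"
proof -
  have "measure_pmf.expectation p (moment_test b) =
    (\<Sum>s\<in>{snapshot False False, snapshot False True, snapshot True True}. moment_test b s * pmf p s)"
    by (rule integral_measure_pmf_real) (auto simp: set_pmf_iff assms split: if_splits)
  moreover have "pmf (snapshot False True) True = 1 / 2" "pmf (snapshot False False) True = 0"
    "pmf (snapshot True True) True = 1"
    by (simp_all add: snapshot_def)
  ultimately show ?thesis
    using snapshot_distinct snapshot_distinct[symmetric]
    by (simp add: assms moment_test_def algebra_simps)
qed

text \<open>The snapshot masses at \<open>f x\<close> are affine in \<open>f x\<close> and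
  \<open>(f x)\<^sup>2\<close>, so averaging over the cell replaces these by
  \<open>eta \<kappa> f 1 c\<close> and \<open>eta \<kappa> f 2 c\<close>.\<close>

lemma pmf_proj2_eta:
  assumes K: "prob_space (\<kappa> c)" and f: "f \<in> borel_measurable (\<kappa> c)"
    and f01: "\<And>x. x \<in> space (\<kappa> c) \<Longrightarrow> 0 \<le> f x \<and> f x \<le> 1"
  shows "pmf (proj2 \<kappa> f c) s =
     (1 - 2 * eta \<kappa> f 1 c + eta \<kappa> f 2 c) * of_bool (s = snapshot False False) +
     2 * (eta \<kappa> f 1 c - eta \<kappa> f 2 c) * of_bool (s = snapshot False True) +
     eta \<kappa> f 2 c * of_bool (s = snapshot True True)"
proof -
  interpret K: prob_space "\<kappa> c" by (rule K)
  have int: "integrable (\<kappa> c) (\<lambda>x. f x ^ j)" for j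
    using f01 f by (intro K.integrable_const_bound[where B = 1]) (auto simp: power_le_one)
  have int1: "integrable (\<kappa> c) f" using int[of 1] by simp
  have "pmf (proj2 \<kappa> f c) s = (\<integral>x. pmf (snapshot_law (f x)) s \<partial>\<kappa> c)"
    by (rule pmf_proj2[of \<kappa> c f, OF K f f01])
  also have "\<dots> = (\<integral>x. (1 - 2 * f x + (f x)\<^sup>2) * of_bool (s = snapshot False False) +
     2 * (f x - (f x)\<^sup>2) * of_bool (s = snapshot False True) +
     (f x)\<^sup>2 * of_bool (s = snapshot True True) \<partial>\<kappa> c)"
    using f01 by (intro Bochner_Integration.integral_cong)
      (auto simp: pmf_snapshot_law power2_eq_square algebra_simps)
  also have "\<dots> = (1 - 2 * eta \<kappa> f 1 c + eta \<kappa> f 2 c) * of_bool (s = snapshot False False) +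
     2 * (eta \<kappa> f 1 c - eta \<kappa> f 2 c) * of_bool (s = snapshot False True) +
     eta \<kappa> f 2 c * of_bool (s = snapshot True True)"
    using int1 int[of 2] by (simp add: eta_def K.prob_space)
  finally show ?thesis .
qed

lemma delta_sum_le_W1:
  assumes K: "prob_space (\<kappa> c)" and f: "f \<in> borel_measurable (\<kappa> c)"
    and f01: "\<And>x. x \<in> space (\<kappa> c) \<Longrightarrow> 0 \<le> f x \<and> f x \<le> 1"
    and ms: "0 \<le> m c" "m c \<le> 1" "0 \<le> s2 c" "s2 c \<le> m c * (1 - m c)"
  shows "delta1 \<kappa> f m c + delta2 \<kappa> f m s2 c
    \<le> 3 / 2 * W1 (snapshot_predictor m s2 c) (proj2 \<kappa> f c)"
proof -
  have "\<bar>(m c + b * second_moment m s2 c) - (eta \<kappa> f 1 c + b * eta \<kappa> f 2 c)\<bar>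
      \<le> 3 / 2 * W1 (snapshot_predictor m s2 c) (proj2 \<kappa> f c)" if b: "b = 1 \<or> b = - 1" for b
    using expectation_diff_le_W1[OF _ moment_test_lipschitz[OF b]]
      expectation_moment_test[OF pmf_snapshot_predictor[of m c s2, OF ms]]
      expectation_moment_test[OF pmf_proj2_eta[of \<kappa> c f, OF K f f01]]
    by (metis zero_less_divide_iff zero_less_numeral)
  from this[of 1] this[of "- 1"] show ?thesis
    unfolding delta1_def delta2_def by linarith
qed

theorem mainTheorem10:
  fixes M :: "'w measure" and S :: "'a measure"
    and X :: "'w \<Rightarrow> 'a" and Y :: "'w \<Rightarrow> bool" and f :: "'a \<Rightarrow> real"
    and P :: "'a set set" and \<kappa> :: "'a set \<Rightarrow> 'a measure"
    and m s2 :: "'a set \<Rightarrow> real" and \<epsilon> :: real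
  assumes "prob_space M"
    and "X \<in> M \<rightarrow>\<^sub>M S" and "Y \<in> M \<rightarrow>\<^sub>M count_space UNIV"
    and "label_probability M S X Y f"
    and "partition_on (space S) P"
    and "conditional_laws (distr M S X) P \<kappa>"
    and "higher_order_predictor S P m s2"
    and "\<epsilon> \<ge> 0"
    and "second_order_calibrated S P \<kappa> f (\<lambda>x. snapshot_predictor m s2 (cell P x)) \<epsilon>"
  shows "CE2 (distr M S X) P \<kappa> f m s2 \<le> 3 / 2 * \<epsilon>"
proof -
  let ?D = "distr M S X"
  interpret D: prob_space ?D
    using assms(1,2) by (rule prob_space.prob_space_distr)
  have P: "partition_on (space ?D) P" using assms(5) by simp
  have fS: "f \<in> borel_measurable S" "\<And>x. x \<in> space S \<Longrightarrow> 0 \<le> f x \<and> f x \<le> 1"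
    using assms(4) by (auto simp: label_probability_def)
  have le: "delta1 \<kappa> f m (cell P x) + delta2 \<kappa> f m s2 (cell P x) \<le> 3 / 2 * \<epsilon>"
    if x: "x \<in> space S" for x
  proof -
    have c: "cell P x \<in> P" using cell_mem(1)[OF assms(5) x] .
    have K: "prob_space (\<kappa> (cell P x))" and sets: "sets (\<kappa> (cell P x)) = sets S"
      using conditional_laws_prob_space[OF P assms(6) c] by simp_all
    have f: "f \<in> borel_measurable (\<kappa> (cell P x))"
      using fS(1) measurable_cong_sets[OF sets refl] by blast
    have f01: "0 \<le> f y \<and> f y \<le> 1" if "y \<in> space (\<kappa> (cell P x))" for y
      using fS(2) that sets_eq_imp_space_eq[OF sets] by auto
    have "delta1 \<kappa> f m (cell P x) + delta2 \<kappa> f m s2 (cell P x)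
        \<le> 3 / 2 * W1 (snapshot_predictor m s2 (cell P x)) (proj2 \<kappa> f (cell P x))"
      using assms(7) c by (intro delta_sum_le_W1 K f f01) (auto simp: higher_order_predictor_def)
    also have "\<dots> \<le> 3 / 2 * \<epsilon>"
      using assms(9) x by (simp add: second_order_calibrated_def)
    finally show ?thesis .
  qed
  \<comment> \<open>\<open>integral_mono'\<close> asks that the dominating constant be nonnegative,
    which is where \<epsilon> \<ge> 0 enters: a non-integrable left side would have integral
    0.\<close>
  have "CE2 ?D P \<kappa> f m s2 \<le> (\<integral>x. 3 / 2 * \<epsilon> \<partial>?D)"
    unfolding CE2_def using le assms(8) by (intro integral_mono') auto
  then show ?thesis using D.prob_space by simp
qed

end
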